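(* The laws of the square of opposition are provable in the formal system $\mathrm{SYLL}^+$; that is, for all term-variables $X,Y$, the following logical consequences are provable in $\mathrm{SYLL}^+$: (1) (laws of contradiction) $\mathbf{A}_{XY},\mathbf{O}_{XY}\vdash\mathbf{O}_{XX}$ and $\mathbf{E}_{XY},\mathbf{I}_{XY}\vdash\mathbf{O}_{XX}$; (2) (laws of subalternation, contrariety and subcontrariety) $\mathbf{A}_{XY},\mathbf{I}_{XX}\vdash\mathbf{I}_{XY}$ and $\mathbf{E}_{XY},\mathbf{I}_{XX}\vdash\mathbf{O}_{XY}$.
   Context: **Diagrams.** The syntactic primitives are the symbols $\to$, $\leftarrow$, $\bullet$ and countably many term-variables $A,B,C,\dots$. A diagram is a finite list of arrow symbols ($\to$ or $\leftarrow$) separated by a single bullet or term-variable, beginning and ending at a term-variable (a single term-variable is a diagram). A part of a diagram is a finite list of consecutive components of it; parts are denoted $\mathcal{D},\mathcal{E}$. For term-variables $A,B$ (possibly equal) the four categorical propositions (Each $A$ is $B$; No $A$ is $B$; Some $A$ is $B$; Some $A$ is not $B$) are represented respectively by the syllogistic diagrams $$\mathbf{A}_{AB}: A\to B,\quad \mathbf{E}_{AB}: A\to\bullet\leftarrow B,\quad \mathbf{I}_{AB}: A\leftarrow\bullet\to B,\quad \mathbf{O}_{AB}: A\leftarrow\bullet\to\bullet\leftarrow B.$$ Here $\mathbf{I}_{XX}$ represents existential import on $X$ and $\mathbf{O}_{XX}$ expresses contradiction. **Rules of inference of $\mathrm{SYLL}^+$** (for all term-variables $A,B$ and all parts $\mathcal{D},\mathcal{E}$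 such that the expressions are diagrams): 1. from $A\to B$ infer $B\leftarrow A$, and conversely; 2. from $A\to\bullet\leftarrow B$ infer $B\to\bullet\leftarrow A$; 3. from $A\leftarrow\bullet\to B$ infer $B\leftarrow\bullet\to A$; 4. from $A\leftarrow\bullet\to\bullet\leftarrow B$ infer $B\to\bullet\leftarrow\bullet\to A$, and conversely; 5. from the two diagrams $\mathcal{D}A$ and $A\mathcal{E}$ (in either order) infer the diagram $\mathcal{D}A\mathcal{E}$ obtained by overlapping them on the common extremal $A$; 6. from $\mathcal{D}\to A\to\mathcal{E}$ infer $\mathcal{D}\to\mathcal{E}$; 7. from $\mathcal{D}\leftarrow A\leftarrow\mathcal{E}$ infer $\mathcal{D}\leftarrow\mathcal{E}$; 8. from no hypotheses infer $A\leftarrow\bullet\to A$. **Provability.** A proof tree is a tree in which each node is a diagram and each branching is an instance of a rule of inference. A logical consequence $P_1,P_2\vdash C$ between categorical propositions is provable if there is a proof tree with the diagram of $C$ as root and the diagrams of $P_1$ and $P_2$ as leaves (a premise $\mathbf{I}_{XX}$ may also be supplied by rule 8). **Laws of the square of opposition.** The laws of contradiction are the two consequences in (1). The remaining laws (subalternation, contrariety, subcontrariety, all under existential import on $X$) are condensed into the two consequences in (2), where $\mathbf{O}_{XY}$ is regarded as the negation of $\mathbf{A}_{XY}$ and $\mathbf{I}_{XY}$ as the negation of $\mathbf{E}_{XY}$, and vice versa. *)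

theory Defs
  imports "HOL-Library.Multiset"
begin

section \<open>Diagrams\<close>

type_synonym tvar = nat

datatype component = Rarr | Larr | Bullet | Var tvar

fun is_arrow :: "component \<Rightarrow> bool" where
  "is_arrow c \<longleftrightarrow> c = Rarr \<or> c = Larr"

text \<open>Lists of arrows separated by single bullets or term-variables, with a bullet or
  term-variable at both ends.\<close>

inductive alternating :: "component list \<Rightarrow> bool" where
  "\<not> is_arrow v \<Longrightarrow> alternating [v]"
| "\<lbrakk>\<not> is_arrow v; is_arrow a; alternating w\<rbrakk> \<Longrightarrow> alternating (v # a # w)"

definition is_diagram :: "component list \<Rightarrow> bool" where
  "is_diagram w \<longleftrightarrow>
     alternating w \<and> (\<exists>A. hd w = Var A) \<and> (\<exists>B. last w = Var B)"

section \<open>Categorical propositions\<close>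

datatype cat_prop =
    PropA tvar tvar \<comment> \<open>Each A is B\<close>
  | PropE tvar tvar \<comment> \<open>No A is B\<close>
  | PropI tvar tvar \<comment> \<open>Some A is B\<close>
  | PropO tvar tvar \<comment> \<open>Some A is not B\<close>

fun diagram_of :: "cat_prop \<Rightarrow> component list" where
  "diagram_of (PropA A B) = [Var A, Rarr, Var B]"
| "diagram_of (PropE A B) = [Var A, Rarr, Bullet, Larr, Var B]"
| "diagram_of (PropI A B) = [Var A, Larr, Bullet, Rarr, Var B]"
| "diagram_of (PropO A B) = [Var A, Larr, Bullet, Rarr, Bullet, Larr, Var B]"

section \<open>Rules of inference\<close>

text \<open>\<open>syll_rule Hs C\<close>: the diagram \<open>C\<close> may be inferred from the list of hypotheses \<open>Hs\<close>.
  Parts of diagrams are arbitrary, possibly empty, lists \<open>D\<close>, \<open>E\<close> such that all the expressions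
  in the rule are diagrams.\<close>

inductive syll_rule :: "component list list \<Rightarrow> component list \<Rightarrow> bool" where
  A_flip:
    "syll_rule [[Var A, Rarr, Var B]] [Var B, Larr, Var A]"
| A_flip_conv:
    "syll_rule [[Var B, Larr, Var A]] [Var A, Rarr, Var B]"
| E_flip:
    "syll_rule [[Var A, Rarr, Bullet, Larr, Var B]] [Var B, Rarr, Bullet, Larr, Var A]"
| I_flip:
    "syll_rule [[Var A, Larr, Bullet, Rarr, Var B]] [Var B, Larr, Bullet, Rarr, Var A]"
| O_flip:
    "syll_rule [[Var A, Larr, Bullet, Rarr, Bullet, Larr, Var B]]
               [Var B, Rarr, Bullet, Larr, Bullet, Rarr, Var A]"
| O_flip_conv:
    "syll_rule [[Var B, Rarr, Bullet, Larr, Bullet, Rarr, Var A]]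
               [Var A, Larr, Bullet, Rarr, Bullet, Larr, Var B]"
| overlap:
    "\<lbrakk>is_diagram (D @ [Var A]); is_diagram ([Var A] @ E); is_diagram (D @ [Var A] @ E)\<rbrakk>
     \<Longrightarrow> syll_rule [D @ [Var A], [Var A] @ E] (D @ [Var A] @ E)"
| overlap_swap:
    "\<lbrakk>is_diagram (D @ [Var A]); is_diagram ([Var A] @ E); is_diagram (D @ [Var A] @ E)\<rbrakk>
     \<Longrightarrow> syll_rule [[Var A] @ E, D @ [Var A]] (D @ [Var A] @ E)"
| compose_right:
    "\<lbrakk>is_diagram (D @ [Rarr, Var A, Rarr] @ E); is_diagram (D @ [Rarr] @ E)\<rbrakk>
     \<Longrightarrow> syll_rule [D @ [Rarr, Var A, Rarr] @ E] (D @ [Rarr] @ E)"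
| compose_left:
    "\<lbrakk>is_diagram (D @ [Larr, Var A, Larr] @ E); is_diagram (D @ [Larr] @ E)\<rbrakk>
     \<Longrightarrow> syll_rule [D @ [Larr, Var A, Larr] @ E] (D @ [Larr] @ E)"
| existential_import:
    "syll_rule [] [Var A, Larr, Bullet, Rarr, Var A]"

section \<open>Proof trees and provability\<close>

text \<open>A childless node is either a \<open>Premise\<close> or an \<open>Infer []\<close> node, the latter being
  justified by existential import.\<close>

datatype tree =
    Premise "component list"
  | Infer "tree list" "component list"

fun root_diagram :: "tree \<Rightarrow> component list" where
  "root_diagram (Premise d) = d"
| "root_diagram (Infer ts d) = d"

fun proof_tree :: "tree \<Rightarrow> bool" where
  "proof_tree (Premise d) \<longleftrightarrow> is_diagram d"
| "proof_tree (Infer ts d) \<longleftrightarrow>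
     is_diagram d \<and> syll_rule (map root_diagram ts) d \<and> (\<forall>t\<in>set ts. proof_tree t)"

fun open_leaves :: "tree \<Rightarrow> component list multiset" where
  "open_leaves (Premise d) = {#d#}"
| "open_leaves (Infer ts d) = sum_list (map open_leaves ts)"

fun leaves :: "tree \<Rightarrow> component list multiset" where
  "leaves (Premise d) = {#d#}"
| "leaves (Infer ts d) = (if ts = [] then {#d#} else sum_list (map leaves ts))"

text \<open>Both premises must occur among the leaves, and no other undischarged leaf may occur.
  The two bounds differ only by leaves justified by existential import, so that a premise
  \<open>PropI X X\<close>, and no other premise, may be supplied by that rule.\<close>

definition provable :: "cat_prop \<Rightarrow> cat_prop \<Rightarrow> cat_prop \<Rightarrow> bool"
    ("_, _ \<turnstile> _" [51, 51, 51] 50) where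
  "(P1, P2 \<turnstile> C) \<longleftrightarrow>
     (\<exists>t. proof_tree t \<and> root_diagram t = diagram_of C \<and>
          open_leaves t \<subseteq># {#diagram_of P1, diagram_of P2#} \<and>
          {#diagram_of P1, diagram_of P2#} \<subseteq># leaves t)"

end

theory Submission
  imports Defs
begin

text \<open>In each case the two premises, one of them flipped if necessary, overlap on a
  term-variable between two arrows of the same direction. Composing through that variable
  deletes it and leaves the conclusion:

  \<^item> \<open>X \<leftarrow> \<bullet> \<rightarrow> \<bullet> \<leftarrow> Y \<leftarrow> X\<close> gives \<open>X \<leftarrow> \<bullet> \<rightarrow> \<bullet> \<leftarrow> X\<close>
  \<^item> \<open>X \<leftarrow> \<bullet> \<rightarrow> Y \<rightarrow> \<bullet> \<leftarrow> X\<close> gives \<open>X \<leftarrow> \<bullet> \<rightarrow> \<bullet> \<leftarrow> X\<close>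
  \<^item> \<open>X \<leftarrow> \<bullet> \<rightarrow> X \<rightarrow> Y\<close> gives \<open>X \<leftarrow> \<bullet> \<rightarrow> Y\<close>
  \<^item> \<open>X \<leftarrow> \<bullet> \<rightarrow> X \<rightarrow> \<bullet> \<leftarrow> Y\<close> gives \<open>X \<leftarrow> \<bullet> \<rightarrow> \<bullet> \<leftarrow> Y\<close>\<close>

text \<open>Requiring both leaf multisets to equal \<open>M\<close> rules out
  \<open>existential_import\<close> nodes, and both bounds in \<open>provable\<close> then hold with
  equality.\<close>

definition derives :: "component list multiset \<Rightarrow> component list \<Rightarrow> bool" where
  "derives M d \<longleftrightarrow>
     (\<exists>t. proof_tree t \<and> root_diagram t = d \<and> open_leaves t = M \<and> leaves t = M)"

lemma derives_premise: "is_diagram d \<Longrightarrow> derives {#d#} d"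
  unfolding derives_def by (intro exI[of _ "Premise d"]) simp

lemma derives_unary:
  assumes "derives M d" "syll_rule [d] c" "is_diagram c"
  shows "derives M c"
proof -
  obtain t where "proof_tree t" "root_diagram t = d" "open_leaves t = M" "leaves t = M"
    using assms(1) unfolding derives_def by blast
  then show ?thesis
    unfolding derives_def using assms(2,3) by (intro exI[of _ "Infer [t] c"]) simp
qed

lemma derives_binary:
  assumes "derives M d" "derives N e" "syll_rule [d, e] c" "is_diagram c"
  shows "derives (M + N) c"
proof -
  obtain t where "proof_tree t" "root_diagram t = d" "open_leaves t = M" "leaves t = M"
    using assms(1) unfolding derives_def by blast
  moreover obtain u where "proof_tree u" "root_diagram u = e" "open_leaves u = N" "leaves u = N"
    using assms(2) unfolding derives_def by blast
  ultimately show ?thesis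
    unfolding derives_def using assms(3,4) by (intro exI[of _ "Infer [t, u] c"]) simp
qed

lemma derives_overlap:
  assumes "derives M (D @ [Var A])" "derives N ([Var A] @ E)"
    and "is_diagram (D @ [Var A])" "is_diagram ([Var A] @ E)" "is_diagram (D @ [Var A] @ E)"
  shows "derives (M + N) (D @ [Var A] @ E)"
  using derives_binary[OF assms(1,2) overlap[OF assms(3-5)] assms(5)] .

lemma derives_compose_right:
  assumes "derives M (D @ [Rarr, Var A])" "derives N ([Var A, Rarr] @ E)"
    and "is_diagram (D @ [Rarr, Var A])" "is_diagram ([Var A, Rarr] @ E)"
    and "is_diagram (D @ [Rarr, Var A, Rarr] @ E)" "is_diagram (D @ [Rarr] @ E)"
  shows "derives (M + N) (D @ [Rarr] @ E)"
proof -
  have "derives (M + N) (D @ [Rarr, Var A, Rarr] @ E)"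
    using derives_overlap[of M "D @ [Rarr]" A N "Rarr # E"] assms(1-5) by simp
  then show ?thesis
    using compose_right[OF assms(5,6)] assms(6) by (rule derives_unary)
qed

lemma derives_compose_left:
  assumes "derives M (D @ [Larr, Var A])" "derives N ([Var A, Larr] @ E)"
    and "is_diagram (D @ [Larr, Var A])" "is_diagram ([Var A, Larr] @ E)"
    and "is_diagram (D @ [Larr, Var A, Larr] @ E)" "is_diagram (D @ [Larr] @ E)"
  shows "derives (M + N) (D @ [Larr] @ E)"
proof -
  have "derives (M + N) (D @ [Larr, Var A, Larr] @ E)"
    using derives_overlap[of M "D @ [Larr]" A N "Larr # E"] assms(1-5) by simp
  then show ?thesis
    using compose_left[OF assms(5,6)] assms(6) by (rule derives_unary)
qed

lemma provableI:
  "derives {#diagram_of P1, diagram_of P2#} (diagram_of C) \<Longrightarrow> (P1, P2 \<turnstile> C)"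
  unfolding derives_def provable_def by force

text \<open>Together with \<open>alternating_simps\<close>, this lets the simplifier check concrete
  diagrams two components at a time.\<close>

lemma is_diagram_Var_Cons:
  "is_diagram (Var A # a # w) \<longleftrightarrow>
     is_arrow a \<and> alternating w \<and> (\<exists>B. last w = Var B)"
  by (auto simp: is_diagram_def intro: alternating.intros elim: alternating.cases)

lemma alternating_simps:
  "alternating [v] \<longleftrightarrow> \<not> is_arrow v"
  "alternating (v # a # w) \<longleftrightarrow> \<not> is_arrow v \<and> is_arrow a \<and> alternating w"
  by (auto intro: alternating.intros elim: alternating.cases)

theorem proposition4p1:
  fixes X Y :: tvar
  shows "(PropA X Y, PropO X Y \<turnstile> PropO X X) \<and> (PropE X Y, PropI X Y \<turnstile> PropO X X) \<and>
         (PropA X Y, PropI X X \<turnstile> PropI X Y) \<and> (PropE X Y, PropI X X \<turnstile> PropO X Y)"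
proof (intro conjI; rule provableI)
  note diagram_simps = is_diagram_Var_Cons alternating_simps
  have premise: "derives {#diagram_of P#} (diagram_of P)" for P
    by (rule derives_premise) (cases P; simp add: diagram_simps)
  \<comment> \<open>The flip makes \<open>Y\<close> the left end, followed by the same arrow that
    precedes \<open>Y\<close> in \<open>PropO X Y\<close>.\<close>
  have "derives {#diagram_of (PropA X Y)#} [Var Y, Larr, Var X]"
    using derives_unary[OF premise[of "PropA X Y"]] A_flip by (simp add: diagram_simps)
  then show "derives {#diagram_of (PropA X Y), diagram_of (PropO X Y)#} (diagram_of (PropO X X))"
    using derives_compose_left[of "{#diagram_of (PropO X Y)#}"
        "[Var X, Larr, Bullet, Rarr, Bullet]" Y "{#diagram_of (PropA X Y)#}" "[Var X]"]
      premise[of "PropO X Y"]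
    by (simp add: diagram_simps add_mset_commute)
  \<comment> \<open>Here the flip matches the right arrow into \<open>Y\<close> that ends
    \<open>PropI X Y\<close>.\<close>
  have "derives {#diagram_of (PropE X Y)#} [Var Y, Rarr, Bullet, Larr, Var X]"
    using derives_unary[OF premise[of "PropE X Y"]] E_flip by (simp add: diagram_simps)
  then show "derives {#diagram_of (PropE X Y), diagram_of (PropI X Y)#} (diagram_of (PropO X X))"
    using derives_compose_right[of "{#diagram_of (PropI X Y)#}"
        "[Var X, Larr, Bullet]" Y "{#diagram_of (PropE X Y)#}" "[Bullet, Larr, Var X]"]
      premise[of "PropI X Y"]
    by (simp add: diagram_simps add_mset_commute)
  \<comment> \<open>The second premise is the left factor of the overlap, hence
    \<open>add_mset_commute\<close>.\<close>
  show "derives {#diagram_of (PropA X Y), diagram_of (PropI X X)#} (diagram_of (PropI X Y))"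
    using derives_compose_right[of "{#diagram_of (PropI X X)#}"
        "[Var X, Larr, Bullet]" X "{#diagram_of (PropA X Y)#}" "[Var Y]"]
      premise[of "PropI X X"] premise[of "PropA X Y"]
    by (simp add: diagram_simps add_mset_commute)
  show "derives {#diagram_of (PropE X Y), diagram_of (PropI X X)#} (diagram_of (PropO X Y))"
    using derives_compose_right[of "{#diagram_of (PropI X X)#}"
        "[Var X, Larr, Bullet]" X "{#diagram_of (PropE X Y)#}" "[Bullet, Larr, Var Y]"]
      premise[of "PropI X X"] premise[of "PropE X Y"]
    by (simp add: diagram_simps add_mset_commute)
qed

end
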